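(* Suppose that the SGQP algorithm (described in the context) with parameter $\bar p$ for a convex function $f:\mathbb{R}^n\to\mathbb{R}$ produces a sequence $\{x_i\}$ that converges to a point $\bar x\in f^{-1}(0)$ such that $0\notin\partial f(\bar x)$, and that the convergence to $\bar x$ is not finite. Let $\bar\alpha>0$ be such that $$\bar\alpha<\sin^{-1}\left(\frac{d(0,\partial f(\bar x))}{\sup_{y\in\partial f(\bar x)}\|y\|}\right).$$ Suppose that $\bar p$ is sufficiently large so that for any $\bar p$ unit vectors in $\mathbb{R}^n$, there are two vectors such that the angle between them is at most $\bar\alpha$. (a) For any $\epsilon>0$, there is an $I>0$ such that if $I<i<k$ and $\angle y_j0y_k\le\bar\alpha$ for some $j\in\{i,i+1,\dots,k-1\}\cap S_{k-1}$, then $$\frac{\|x_k-\bar x\|}{\|x_i-\bar x\|}\le\frac{\|x_k-\bar x\|}{\|x_j-\bar x\|}\le\epsilon.$$ (b) If in addition $f$ is strongly semismooth at $\bar x$, then there are $M>0$ and $I>0$ such that if $I<i<k$ and $\angle y_j0y_k\le\bar\alpha$ for some $j\in\{i,i+1,\dots,k-1\}\cap S_{k-1}$, then $$\frac{\|x_k-\bar x\|}{\|x_i-\bar x\|^2}\le\frac{\|x_k-\bar x\|}{\|x_j-\bar x\|^2}<M.$$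
   Context: Notation: $\partial f(x)=\{y\mid f(x')\ge f(x)+\langle y,x'-x\rangle\ \forall x'\in\mathbb{R}^n\}$ is the convex subdifferential; $d(x,S)$ is the distance from $x$ to $S$; $\mathrm{conv}$ is the convex hull; $\mathrm{pos}(S)=\{ts\mid t\ge0,\ s\in S\}$; $\angle u0v$ is the angle at the origin between nonzero vectors $u$ and $v$. SGQP algorithm for finding a point with $f\le 0$. Given a convex function $f:\mathbb{R}^n\to\mathbb{R}$, a starting point $x_0$ and a positive integer $\bar p$, for $i=0,1,2,\dots$: Step 1. Find $y_i\in\partial f(x_i)$ and define $H_i^{\le}=\{x\in\mathbb{R}^n\mid f(x_i)+\langle y_i,x-x_i\rangle\le 0\}$. Step 2. Choose $S_i\subset\{\max(i-\bar p,0),\dots,i\}$, let $F_i=\bigcap_{k\in S_i}H_k^{\le}$, and find $x_{i+1}$ such that (1) $x_{i+1}\in F_i$; (2) $\|x_{i+1}-c\|\le\|x_i-c\|$ for all $c\in f^{-1}((-\infty,0])$; (3) $x_i-x_{i+1}\in\mathrm{pos}(\mathrm{conv}\{y_k\}_{k\in S_i})$, i.e. $x_i-x_{i+1}$ lies in the cone generated by the convex hull of the normals of the halfspaces $H_k^{\le}$, $k\in S_i$. "The convergence is not finite" means that $x_i\ne\bar x$ for all $i$. A convex function $\Phi:\mathbb{R}^n\to\mathbb{R}$ is semismooth at $x$ if it is directionally differentiable at $x$ and for any $V\in\partial\Phi(x+h)$, $\Phi(x+h)-\Phi(x)-Vh=o(\|h\|)$; it is strongly semismooth at $x$ if it is semismooth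 at $x$ and for any $V\in\partial\Phi(x+h)$, $\Phi(x+h)-\Phi(x)-Vh=O(\|h\|^2)$ (as $h\to0$). *)

theory Defs
  imports "HOL-Analysis.Analysis"
begin

definition subdifferential :: "('a::real_inner \<Rightarrow> real) \<Rightarrow> 'a \<Rightarrow> 'a set" where
  "subdifferential f x = {y. \<forall>x'. f x' \<ge> f x + y \<bullet> (x' - x)}"

(* The angle at the origin.  It is only meaningful for nonzero u and v; otherwise the
   division by 0 makes it pi / 2. *)
definition angle0 :: "'a::real_inner \<Rightarrow> 'a \<Rightarrow> real" where
  "angle0 u v = arccos (u \<bullet> v / (norm u * norm v))"

definition directionally_differentiable_at ::
    "('a::real_normed_vector \<Rightarrow> real) \<Rightarrow> 'a \<Rightarrow> bool" where
  "directionally_differentiable_at \<Phi> x \<longleftrightarrow>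
     (\<forall>d. \<exists>D. ((\<lambda>t. (\<Phi> (x + t *\<^sub>R d) - \<Phi> x) / t) \<longlongrightarrow> D) (at_right 0))"

(* The o(norm h) and O((norm h)^2) bounds below are uniform in the choice of the
   subgradient V at x + h. *)
definition semismooth_at :: "('a::real_inner \<Rightarrow> real) \<Rightarrow> 'a \<Rightarrow> bool" where
  "semismooth_at \<Phi> x \<longleftrightarrow>
     directionally_differentiable_at \<Phi> x \<and>
     (\<forall>\<epsilon>>0. \<forall>\<^sub>F h in at 0. \<forall>V \<in> subdifferential \<Phi> (x + h).
        \<bar>\<Phi> (x + h) - \<Phi> x - V \<bullet> h\<bar> \<le> \<epsilon> * norm h)"

definition strongly_semismooth_at :: "('a::real_inner \<Rightarrow> real) \<Rightarrow> 'a \<Rightarrow> bool" where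
  "strongly_semismooth_at \<Phi> x \<longleftrightarrow>
     semismooth_at \<Phi> x \<and>
     (\<exists>C. \<forall>\<^sub>F h in at 0. \<forall>V \<in> subdifferential \<Phi> (x + h).
        \<bar>\<Phi> (x + h) - \<Phi> x - V \<bullet> h\<bar> \<le> C * (norm h)\<^sup>2)"

definition halfspace_le :: "('a::real_inner \<Rightarrow> real) \<Rightarrow> 'a \<Rightarrow> 'a \<Rightarrow> 'a set" where
  "halfspace_le f a y = {z. f a + y \<bullet> (z - a) \<le> 0}"

(* x, y, S are the iterates, subgradients and index sets of one run of the SGQP algorithm
   from x0 with memory parameter p.
   - Subtraction on nat truncates, so {i - p..i} is {max (i - p) 0, ..., i}.
   - cone hull A = {c *R a | c a. c >= 0 and a in A} by cone_hull_expl, which is pos(A);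
     in particular it is empty for empty A, so every S i is nonempty. *)
definition sgqp_run ::
    "('a::real_inner \<Rightarrow> real) \<Rightarrow> 'a \<Rightarrow> nat \<Rightarrow>
     (nat \<Rightarrow> 'a) \<Rightarrow> (nat \<Rightarrow> 'a) \<Rightarrow> (nat \<Rightarrow> nat set) \<Rightarrow> bool" where
  "sgqp_run f x0 p x y S \<longleftrightarrow>
     x 0 = x0 \<and>
     (\<forall>i. y i \<in> subdifferential f (x i) \<and>
          S i \<subseteq> {i - p..i} \<and>
          x (Suc i) \<in> (\<Inter>k\<in>S i. halfspace_le f (x k) (y k)) \<and>
          (\<forall>c\<in>f -` {..0}. norm (x (Suc i) - c) \<le> norm (x i - c)) \<and>
          x i - x (Suc i) \<in> cone hull (convex hull (y ` S i)))"

end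

theory Submission
  imports Defs
begin

text \<open>
  Write \<open>D\<close> for the subdifferential at the limit, \<open>d > 0\<close> for its distance to the origin and \<open>R\<close>
  for the largest norm of its elements.  Everything rests on the outer semicontinuity of the
  subdifferential: late subgradients \<open>y\<^sub>i\<close> are close to \<open>D\<close>
  (\<open>eventually_subgradient_near\<close>).  It is used in three ways.

  \<^item> Every late step \<open>x\<^sub>i - x\<^sub>i\<^sub>+\<^sub>1\<close> lies in the convex cone generated by a small convex neighbourhood
    of \<open>D\<close>.  Summing the steps, so does \<open>x\<^sub>k - x\<^sub>m\<close> for \<open>m \<ge> k\<close>, and in such directions \<open>f\<close> grows
    from the limit with slope almost \<open>d\<close>.  Letting \<open>m\<close> tend to infinity, \<open>f(x\<^sub>k)\<close> is at least almost
    \<open>d\<close> times the distance of \<open>x\<^sub>k\<close> to the limit (\<open>sgqp_linear_growth\<close>).  As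
    \<open>\<langle>y\<^sub>k, x\<^sub>k - xbar\<rangle> \<ge> f(x\<^sub>k)\<close>, the angle between \<open>y\<^sub>k\<close> and \<open>x\<^sub>k - xbar\<close> is at most roughly
    \<open>\<pi>/2 - arcsin (d/R)\<close>.

  \<^item> If \<open>y\<^sub>j\<close> is within \<open>\<alpha> < arcsin (d/R)\<close> of \<open>y\<^sub>k\<close>, the triangle inequality for angles
    (\<open>angle0_triangle\<close>) makes the angle between \<open>y\<^sub>j\<close> and \<open>x\<^sub>k - xbar\<close> acute by a fixed margin.
    Since \<open>y\<^sub>j\<close> is bounded away from \<open>0\<close>, this gives
    \<open>\<langle>y\<^sub>j, x\<^sub>k - xbar\<rangle> \<ge> \<kappa> \<parallel>x\<^sub>k - xbar\<parallel>\<close> with a constant \<open>\<kappa> > 0\<close>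
    (\<open>sgqp_aligned_subgradient\<close>).

  \<^item> On the other hand \<open>x\<^sub>k\<close> lies in the halfspace cut out at \<open>x\<^sub>j\<close>, so \<open>\<langle>y\<^sub>j, x\<^sub>k - xbar\<rangle>\<close> is at
    most the linearization error \<open>\<langle>y\<^sub>j, x\<^sub>j - xbar\<rangle> - f(x\<^sub>j)\<close>.  This error is
    \<open>o(\<parallel>x\<^sub>j - xbar\<parallel>)\<close>, because \<open>y\<^sub>j\<close> may be compared with a nearby element of \<open>D\<close>
    (\<open>eventually_linearization_error\<close>), and \<open>O(\<parallel>x\<^sub>j - xbar\<parallel>\<^sup>2)\<close> under strong semismoothness.

  Comparing the two bounds on \<open>\<langle>y\<^sub>j, x\<^sub>k - xbar\<rangle>\<close> yields both estimates for \<open>x\<^sub>j\<close>; the ones for \<open>x\<^sub>i\<close>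
  follow because the distance to the limit never increases along the run.
\<close>

section \<open>Limits of subgradients\<close>

lemma subdifferential_ineq:
  assumes "v \<in> subdifferential f a"
  shows "f b \<ge> f a + v \<bullet> (b - a)"
  using assms unfolding subdifferential_def by blast

lemma subdifferential_limit:
  fixes f :: "'a::real_inner \<Rightarrow> real"
  assumes cont: "continuous_on UNIV f"
    and x: "x \<longlonglongrightarrow> a" and y: "y \<longlonglongrightarrow> v"
    and sub: "\<And>n::nat. y n \<in> subdifferential f (x n)"
  shows "v \<in> subdifferential f a"
proof -
  have "f b \<ge> f a + v \<bullet> (b - a)" for b
  proof (rule LIMSEQ_le_const2)
    have "(\<lambda>n. f (x n)) \<longlonglongrightarrow> f a"
      using cont x by (simp add: continuous_on_eq_continuous_at isCont_tendsto_compose)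
    then show "(\<lambda>n. f (x n) + y n \<bullet> (b - x n)) \<longlonglongrightarrow> f a + v \<bullet> (b - a)"
      by (intro tendsto_intros x y)
    show "\<exists>N. \<forall>n\<ge>N. f (x n) + y n \<bullet> (b - x n) \<le> f b"
      using subdifferential_ineq[OF sub] by blast
  qed
  then show ?thesis unfolding subdifferential_def by blast
qed

text \<open>Moving from \<open>a\<close> by a unit step along \<open>v\<close> raises \<open>f\<close> by at least \<open>\<parallel>v\<parallel>\<close>, while \<open>f\<close> is
  bounded on a ball containing all these points.\<close>

lemma subgradients_bounded:
  fixes f :: "'a::euclidean_space \<Rightarrow> real"
  assumes cont: "continuous_on UNIV f" and A: "bounded A"
  shows "bounded (\<Union>a\<in>A. subdifferential f a)"
proof -
  obtain r where r: "\<And>a. a \<in> A \<Longrightarrow> norm a \<le> r"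
    using A unfolding bounded_iff by blast
  have "compact (f ` cball 0 (r + 1))"
    using cont by (intro compact_continuous_image) (auto intro: continuous_on_subset)
  then obtain B where B: "\<And>z. norm z \<le> r + 1 \<Longrightarrow> \<bar>f z\<bar> \<le> B"
    by (fastforce dest!: compact_imp_bounded simp: bounded_iff)
  have "norm v \<le> 2 * B" if "a \<in> A" "v \<in> subdifferential f a" for a v
  proof -
    have "norm v = v \<bullet> sgn v"
      by (cases "v = 0") (simp_all add: sgn_div_norm dot_square_norm power2_eq_square)
    also have "\<dots> \<le> f (a + sgn v) - f a"
      using subdifferential_ineq[OF that(2), of "a + sgn v"] by simp
    also have "\<dots> \<le> 2 * B"
    proof -
      have "norm (a + sgn v) \<le> r + 1"
        using norm_triangle_ineq[of a "sgn v"] r[OF that(1)] by (simp add: norm_sgn split: if_splits)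
      moreover have "norm a \<le> r + 1" using r[OF that(1)] by simp
      ultimately show ?thesis using B[of "a + sgn v"] B[of a] by linarith
    qed
    finally show ?thesis .
  qed
  then show ?thesis unfolding bounded_iff by blast
qed

text \<open>Otherwise a bounded subsequence of subgradients stays away from the subdifferential at the
  limit, but any accumulation point of it belongs there.\<close>

lemma eventually_subgradient_near:
  fixes f :: "'a::euclidean_space \<Rightarrow> real"
  assumes cont: "continuous_on UNIV f" and x: "x \<longlonglongrightarrow> a"
    and sub: "\<And>n::nat. y n \<in> subdifferential f (x n)" and "\<delta> > 0"
  shows "\<forall>\<^sub>F n in sequentially. \<exists>w\<in>subdifferential f a. norm (y n - w) \<le> \<delta>"
proof (rule ccontr)
  assume "\<not> ?thesis"
  then obtain r :: "nat \<Rightarrow> nat" where r: "strict_mono r"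
    and far: "\<And>n. \<not> (\<exists>w\<in>subdifferential f a. norm (y (r n) - w) \<le> \<delta>)"
    by (blast dest: not_eventually_sequentiallyD)
  have "bounded (range x)" using x by (auto intro: convergent_imp_bounded)
  from subgradients_bounded[OF cont this] have "bounded (range (y \<circ> r))"
    by (rule bounded_subset) (use sub in auto)
  then obtain v s where s: "strict_mono (s::nat \<Rightarrow> nat)" and lim: "((y \<circ> r) \<circ> s) \<longlonglongrightarrow> v"
    using bounded_imp_convergent_subsequence by blast
  have "(x \<circ> (r \<circ> s)) \<longlonglongrightarrow> a"
    using x r s by (intro LIMSEQ_subseq_LIMSEQ strict_mono_o)
  from subdifferential_limit[OF cont this lim] have "v \<in> subdifferential f a"
    using sub by simp
  moreover obtain n where "norm (((y \<circ> r) \<circ> s) n - v) < \<delta>"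
    using LIMSEQ_D[OF lim \<open>\<delta> > 0\<close>] by blast
  ultimately show False using far[of "s n"] by force
qed

lemma closed_subdifferential:
  fixes f :: "'a::real_inner \<Rightarrow> real"
  shows "closed (subdifferential f a)"
proof -
  have "subdifferential f a = (\<Inter>b. {v. f a + v \<bullet> (b - a) \<le> f b})"
    unfolding subdifferential_def by auto
  moreover have "closed {v. f a + v \<bullet> (b - a) \<le> f b}" for b
    by (intro closed_Collect_le continuous_intros)
  ultimately show ?thesis by auto
qed

lemma convex_subdifferential:
  fixes f :: "'a::real_inner \<Rightarrow> real"
  shows "convex (subdifferential f a)"
proof -
  have "subdifferential f a = (\<Inter>b. {v. (b - a) \<bullet> v \<le> f b - f a})"
    unfolding subdifferential_def by (auto simp: inner_commute algebra_simps)
  then show ?thesis by (simp add: convex_INT convex_halfspace_le)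
qed

text \<open>The one-sided semismoothness of a convex function: the affine minorant at \<open>a\<close> given by a nearby
  \<open>w\<close> in the subdifferential at \<open>a\<close> bounds \<open>f (x n)\<close> from below, and replacing \<open>w\<close> by \<open>y n\<close> costs at
  most \<open>\<parallel>y n - w\<parallel> \<parallel>x n - a\<parallel>\<close>.\<close>

lemma eventually_linearization_error:
  fixes f :: "'a::euclidean_space \<Rightarrow> real"
  assumes cont: "continuous_on UNIV f" and x: "x \<longlonglongrightarrow> a"
    and sub: "\<And>n::nat. y n \<in> subdifferential f (x n)" and "\<delta> > 0"
  shows "\<forall>\<^sub>F n in sequentially. y n \<bullet> (x n - a) - (f (x n) - f a) \<le> \<delta> * norm (x n - a)"
  using eventually_subgradient_near[OF assms]
proof eventually_elim
  case (elim n)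
  then obtain w where w: "w \<in> subdifferential f a" and near: "norm (y n - w) \<le> \<delta>" by blast
  have "y n \<bullet> (x n - a) - (f (x n) - f a) \<le> (y n - w) \<bullet> (x n - a)"
    using subdifferential_ineq[OF w, of "x n"] by (simp add: inner_diff_left)
  also have "\<dots> \<le> norm (y n - w) * norm (x n - a)" by (rule norm_cauchy_schwarz)
  also have "\<dots> \<le> \<delta> * norm (x n - a)" using near by (simp add: mult_right_mono)
  finally show ?case .
qed

section \<open>Angles\<close>

lemma normalized_inner_bounds:
  fixes u v :: "'a::real_inner"
  shows "-1 \<le> u \<bullet> v / (norm u * norm v)" "u \<bullet> v / (norm u * norm v) \<le> 1"
proof -
  have "\<bar>u \<bullet> v / (norm u * norm v)\<bar> \<le> 1"
    using Cauchy_Schwarz_ineq2[of u v] by (cases "u = 0 \<or> v = 0") (auto simp: pos_divide_le_eq)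
  then show "-1 \<le> u \<bullet> v / (norm u * norm v)" "u \<bullet> v / (norm u * norm v) \<le> 1"
    unfolding abs_le_iff by linarith+
qed

lemma cos_angle0: "cos (angle0 u v) = u \<bullet> v / (norm u * norm v)"
  unfolding angle0_def by (rule cos_arccos[OF normalized_inner_bounds])

lemma angle0_bounds: "0 \<le> angle0 u v" "angle0 u v \<le> pi"
  unfolding angle0_def using arccos_bounded[OF normalized_inner_bounds] by auto

text \<open>For unit vectors, split \<open>u\<close> and \<open>w\<close> into components along \<open>v\<close> and orthogonal to \<open>v\<close>.  The
  Cauchy-Schwarz inequality for the orthogonal parts, whose norms are the sines of the two angles,
  then says that \<open>u \<bullet> w\<close> is at least the cosine of the sum of the angles, which is decisive as long
  as this sum is at most \<open>\<pi>\<close>.\<close>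

lemma angle0_triangle:
  fixes u v w :: "'a::real_inner"
  assumes "u \<noteq> 0" "v \<noteq> 0" "w \<noteq> 0"
  shows "angle0 u w \<le> angle0 u v + angle0 v w"
proof (cases "angle0 u v + angle0 v w \<le> pi")
  case False
  then show ?thesis using angle0_bounds(2)[of u w] by linarith
next
  case True
  define A B where "A = angle0 u v" and "B = angle0 v w"
  define a b c where "a = sgn u" and "b = sgn v" and "c = sgn w"
  have unit: "a \<bullet> a = 1" "b \<bullet> b = 1" "c \<bullet> c = 1"
    using assms by (simp_all add: a_def b_def c_def dot_square_norm norm_sgn)
  have cosA: "cos A = a \<bullet> b" and cosB: "cos B = b \<bullet> c" and cosAB: "cos (angle0 u w) = a \<bullet> c"
    by (simp_all add: A_def B_def cos_angle0 a_def b_def c_def sgn_div_norm field_simps)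
  have sin0: "sin A \<ge> 0" "sin B \<ge> 0"
    using angle0_bounds by (auto simp: A_def B_def intro!: sin_ge_zero)
  define a' c' where "a' = a - cos A *\<^sub>R b" and "c' = c - cos B *\<^sub>R b"
  have "a' \<bullet> a' = 1 - (cos A)\<^sup>2"
    using unit by (simp add: a'_def cosA inner_diff_left inner_diff_right inner_commute power2_eq_square)
  then have na: "norm a' = sin A"
    using sin0 by (simp add: norm_eq_sqrt_inner flip: sin_squared_eq)
  have "c' \<bullet> c' = 1 - (cos B)\<^sup>2"
    using unit by (simp add: c'_def cosB inner_diff_left inner_diff_right inner_commute power2_eq_square)
  then have nc: "norm c' = sin B"
    using sin0 by (simp add: norm_eq_sqrt_inner flip: sin_squared_eq)
  have "a' \<bullet> c' = a \<bullet> c - cos A * cos B"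
    using unit by (simp add: a'_def c'_def cosA cosB inner_diff_left inner_diff_right inner_commute)
  moreover have "- (sin A * sin B) \<le> a' \<bullet> c'"
    using Cauchy_Schwarz_ineq2[of a' c'] by (simp add: na nc)
  ultimately have "cos (A + B) \<le> cos (angle0 u w)"
    by (simp add: cos_add cosAB)
  moreover have "0 \<le> A + B" "A + B \<le> pi"
    using True angle0_bounds(1)[of u v] angle0_bounds(1)[of v w] by (simp_all add: A_def B_def)
  ultimately show ?thesis
    using angle0_bounds[of u w] by (simp add: cos_mono_le_eq A_def B_def)
qed

text \<open>The triangle inequality in the form in which it is applied: \<open>\<gamma>\<close> measures how far \<open>v\<close> and \<open>z\<close>
  are from being orthogonal, and turning \<open>v\<close> by at most \<open>\<alpha>\<close> loses at most \<open>\<alpha>\<close> of this.\<close>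

lemma inner_ge_of_angle0_le:
  fixes u v z :: "'a::real_inner"
  assumes nz: "u \<noteq> 0" "v \<noteq> 0" "z \<noteq> 0"
    and angle: "angle0 u v \<le> \<alpha>" and "\<alpha> \<le> \<gamma>" "\<gamma> \<le> pi / 2"
    and inner: "v \<bullet> z \<ge> sin \<gamma> * (norm v * norm z)"
  shows "u \<bullet> z \<ge> sin (\<gamma> - \<alpha>) * (norm u * norm z)"
proof -
  have "0 \<le> \<alpha>" using angle0_bounds(1)[of u v] angle by linarith
  have "cos (pi / 2 - \<gamma>) \<le> cos (angle0 v z)"
    using nz inner by (simp add: cos_angle0 cos_diff pos_le_divide_eq)
  then have "angle0 v z \<le> pi / 2 - \<gamma>"
    using angle0_bounds[of v z] \<open>0 \<le> \<alpha>\<close> assms(5,6) by (subst (asm) cos_mono_le_eq) auto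
  then have "angle0 u z \<le> pi / 2 - (\<gamma> - \<alpha>)"
    using angle0_triangle[OF nz] angle by linarith
  then have "cos (pi / 2 - (\<gamma> - \<alpha>)) \<le> cos (angle0 u z)"
    using angle0_bounds[of u z] \<open>0 \<le> \<alpha>\<close> assms(5,6) by (subst cos_mono_le_eq) auto
  then have "sin (\<gamma> - \<alpha>) \<le> u \<bullet> z / (norm u * norm z)"
    by (simp add: cos_angle0 cos_diff)
  then show ?thesis using nz by (simp add: pos_le_divide_eq)
qed

section \<open>Geometry of a convergent run\<close>

text \<open>If \<open>z = t v\<close> with \<open>v\<close> within \<open>\<delta>\<close> of a subgradient \<open>w\<close> at \<open>a\<close>, then \<open>\<langle>w, v\<rangle> \<ge> \<parallel>v\<parallel> (\<parallel>v\<parallel> - \<delta>)\<close>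
  and \<open>\<parallel>v\<parallel> \<ge> d - \<delta>\<close>, where \<open>d\<close> is the distance from the origin to the subdifferential; the affine
  minorant with slope \<open>w\<close> then gives the growth.\<close>

lemma growth_in_subdifferential_cone:
  fixes f :: "'a::real_inner \<Rightarrow> real"
  assumes z: "z \<in> cone hull (\<Union>w\<in>subdifferential f a. \<Union>e\<in>cball 0 \<delta>. {w + e})"
  shows "f (a + z) \<ge> f a + (infdist 0 (subdifferential f a) - 2 * \<delta>) * norm z"
proof -
  let ?d = "infdist 0 (subdifferential f a)"
  obtain t w e where zt: "z = t *\<^sub>R (w + e)" and t: "t \<ge> 0"
    and w: "w \<in> subdifferential f a" and e: "norm e \<le> \<delta>"
    using z unfolding cone_hull_expl by auto
  have "?d \<le> norm w" using infdist_le[OF w, of 0] by simp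
  then have v: "?d - \<delta> \<le> norm (w + e)"
    using norm_triangle_ineq4[of "w + e" e] e by simp
  have "norm (w + e) * (?d - 2 * \<delta>) \<le> norm (w + e) * (norm (w + e) - \<delta>)"
    using v by (intro mult_left_mono) auto
  also have "\<dots> \<le> (w + e) \<bullet> (w + e) - norm e * norm (w + e)"
    using mult_right_mono[OF e, of "norm (w + e)"]
    by (simp add: dot_square_norm power2_eq_square algebra_simps)
  also have "\<dots> \<le> w \<bullet> (w + e)"
    using norm_cauchy_schwarz[of e "w + e"] by (simp add: inner_add_left)
  finally have "t * (norm (w + e) * (?d - 2 * \<delta>)) \<le> t * (w \<bullet> (w + e))"
    using t by (rule mult_left_mono)
  then have "(?d - 2 * \<delta>) * norm z \<le> w \<bullet> z"
    using t by (simp add: zt mult_ac)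
  then show ?thesis using subdifferential_ineq[OF w, of "a + z"] by simp
qed

lemma convex_cone_hull_add:
  assumes "convex C" "u \<in> cone hull C" "v \<in> cone hull C"
  shows "u + v \<in> cone hull C"
  using convex_cone_hull[OF assms(1)] cone_cone_hull[of C] assms(2,3) convex_cone[of "cone hull C"]
  by blast

text \<open>The growth inequality is proved for the partial sums \<open>x k - x m\<close> of the steps and passes to the
  limit in \<open>m\<close> by continuity of \<open>f\<close>; a limit of membership in the cone would require the cone to
  be closed.\<close>

lemma sgqp_linear_growth:
  fixes f :: "'a::euclidean_space \<Rightarrow> real"
  assumes cont: "continuous_on UNIV f" and run: "sgqp_run f x0 p x y S"
    and lim: "x \<longlonglongrightarrow> a" and "\<delta> > 0"
  shows "\<forall>\<^sub>F k in sequentially.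
    f (x k) \<ge> f a + (infdist 0 (subdifferential f a) - 2 * \<delta>) * norm (x k - a)"
proof -
  let ?c = "infdist 0 (subdifferential f a) - 2 * \<delta>"
  define C where "C = (\<Union>w\<in>subdifferential f a. \<Union>e\<in>cball 0 \<delta>. {w + e})"
  have C: "convex C"
    unfolding C_def by (intro convex_sums convex_subdifferential convex_cball)
  have sub: "\<And>i. y i \<in> subdifferential f (x i)" and S: "\<And>i. S i \<subseteq> {i - p..i}"
    and step: "\<And>i. x i - x (Suc i) \<in> cone hull (convex hull (y ` S i))"
    using run unfolding sgqp_run_def by auto
  obtain N where N: "\<And>i. i \<ge> N \<Longrightarrow> \<exists>w\<in>subdifferential f a. norm (y i - w) \<le> \<delta>"
    using eventually_subgradient_near[OF cont lim sub \<open>\<delta> > 0\<close>]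
    unfolding eventually_sequentially by blast
  have yC: "y i \<in> C" if "i \<ge> N" for i
  proof -
    obtain w where "w \<in> subdifferential f a" "norm (y i - w) \<le> \<delta>"
      using N[OF \<open>i \<ge> N\<close>] by blast
    moreover have "y i = w + (y i - w)" by simp
    ultimately show ?thesis unfolding C_def by fastforce
  qed
  have stepC: "x i - x (Suc i) \<in> cone hull C" if "i \<ge> N + p" for i
  proof -
    have "y ` S i \<subseteq> C" using S[of i] that by (force intro!: yC)
    then have "convex hull (y ` S i) \<subseteq> C" using C by (rule hull_minimal)
    then show ?thesis using step[of i] hull_mono by blast
  qed
  have tail: "x k - x (Suc (k + n)) \<in> cone hull C" if "k \<ge> N + p" for k n
  proof (induction n)
    case 0
    then show ?case using stepC[OF that] by simp
  next
    case (Suc n)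
    have "x (Suc (k + n)) - x (Suc (k + Suc n)) \<in> cone hull C"
      using stepC[of "Suc (k + n)"] that by simp
    from convex_cone_hull_add[OF C Suc this] show ?case by simp
  qed
  have "f (x k) \<ge> f a + ?c * norm (x k - a)" if "k \<ge> N + p" for k
  proof (rule LIMSEQ_le)
    have l: "(\<lambda>n. x (Suc (k + n))) \<longlonglongrightarrow> a"
      using LIMSEQ_ignore_initial_segment[OF lim, of "Suc k"] by (simp add: add.commute)
    then show "(\<lambda>n. f a + ?c * norm (x k - x (Suc (k + n)))) \<longlonglongrightarrow> f a + ?c * norm (x k - a)"
      by (intro tendsto_intros)
    have "(\<lambda>n. a + (x k - x (Suc (k + n)))) \<longlonglongrightarrow> a + (x k - a)"
      by (intro tendsto_intros l)
    moreover have "isCont f (a + (x k - a))"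
      using cont by (simp add: continuous_on_eq_continuous_at)
    ultimately have "(\<lambda>n. f (a + (x k - x (Suc (k + n))))) \<longlonglongrightarrow> f (a + (x k - a))"
      by (rule isCont_tendsto_compose[rotated])
    then show "(\<lambda>n. f (a + (x k - x (Suc (k + n))))) \<longlonglongrightarrow> f (x k)"
      by simp
    show "\<exists>M. \<forall>n\<ge>M. f a + ?c * norm (x k - x (Suc (k + n)))
        \<le> f (a + (x k - x (Suc (k + n))))"
      using growth_in_subdifferential_cone[of _ \<delta> f a] tail[OF that] unfolding C_def by blast
  qed
  then show ?thesis unfolding eventually_sequentially by blast
qed

text \<open>The hypothesis on \<open>\<alpha>\<close> leaves room for an angle \<open>\<gamma>\<close> with \<open>\<alpha> < \<gamma> < arcsin (d/R)\<close>.  The growth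
  of \<open>f\<close> puts \<open>y k\<close> within \<open>\<pi>/2 - \<gamma>\<close> of \<open>x k - a\<close> for late \<open>k\<close>, so that any \<open>y j\<close> within \<open>\<alpha>\<close> of
  \<open>y k\<close> is within \<open>\<pi>/2 - (\<gamma> - \<alpha>)\<close> of it.\<close>

lemma sgqp_aligned_subgradient:
  fixes f :: "'a::euclidean_space \<Rightarrow> real"
  assumes cont: "continuous_on UNIV f" and run: "sgqp_run f x0 p x y S"
    and lim: "x \<longlonglongrightarrow> a" and nz: "0 \<notin> subdifferential f a" and ne: "\<And>i. x i \<noteq> a"
    and "\<alpha> > 0"
    and \<alpha>: "\<alpha> < arcsin (infdist 0 (subdifferential f a) / (SUP v\<in>subdifferential f a. norm v))"
  obtains \<kappa> N where "\<kappa> > 0"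
    "\<And>j k. j \<ge> N \<Longrightarrow> k \<ge> N \<Longrightarrow> angle0 (y j) (y k) \<le> \<alpha> \<Longrightarrow> y j \<bullet> (x k - a) \<ge> \<kappa> * norm (x k - a)"
proof -
  define D where "D = subdifferential f a"
  define d where "d = infdist 0 D"
  define R where "R = (SUP v\<in>D. norm v)"
  have sub: "\<And>i. y i \<in> subdifferential f (x i)"
    using run unfolding sgqp_run_def by auto
  have D0: "D \<noteq> {}"
    using eventually_subgradient_near[OF cont lim sub, of 1] unfolding D_def eventually_sequentially
    by (metis empty_iff le_refl zero_less_one)
  have "d > 0"
    unfolding d_def using nz D0 closed_subdifferential[of f a]
    by (metis D_def in_closed_iff_infdist_zero infdist_nonneg less_eq_real_def)
  have "bounded D" using subgradients_bounded[OF cont, of "{a}"] by (simp add: D_def)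
  then have R: "norm w \<le> R" if "w \<in> D" for w
    unfolding R_def using that by (intro cSUP_upper) (auto simp: bounded_iff bdd_above_def)
  have d: "d \<le> norm w" if "w \<in> D" for w
    using infdist_le[OF that, of 0] by (simp add: d_def)
  have "d \<le> R" using D0 d R by force
  then have "R > 0" "d / R \<le> 1" using \<open>d > 0\<close> by auto
  define \<gamma> where "\<gamma> = (\<alpha> + arcsin (d / R)) / 2"
  have \<gamma>: "\<alpha> < \<gamma>" "\<gamma> < arcsin (d / R)"
    using \<alpha> by (simp_all add: \<gamma>_def d_def D_def R_def)
  have dR: "-1 \<le> d / R" "d / R \<le> 1" using \<open>d > 0\<close> \<open>R > 0\<close> \<open>d / R \<le> 1\<close>
    by (auto intro: order_trans[of _ 0])
  have \<gamma>2: "\<gamma> < pi / 2" using \<gamma>(2) arcsin_bounded[OF dR] by linarith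
  have "sin \<gamma> < sin (arcsin (d / R))"
    using \<gamma> \<open>\<alpha> > 0\<close> arcsin_bounded[OF dR] by (intro sin_monotone_2pi) auto
  then have "sin \<gamma> < d / R" using dR by simp
  then have gap: "R * sin \<gamma> < d" using \<open>R > 0\<close> by (simp add: pos_less_divide_eq mult.commute)
  have sin\<gamma>: "0 < sin \<gamma>" using \<gamma> \<gamma>2 \<open>\<alpha> > 0\<close> by (intro sin_gt_zero) auto
  \<comment> \<open>Small enough for the perturbed ratio \<open>(d - 2\<delta>) / (R + \<delta>)\<close> still to be at least \<open>sin \<gamma>\<close>.\<close>
  define \<delta> where "\<delta> = (d - R * sin \<gamma>) / 3"
  then have \<delta>: "\<delta> > 0" and \<delta>3: "3 * \<delta> = d - R * sin \<gamma>" using gap by simp_all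
  have "R * sin \<gamma> > 0" using \<open>R > 0\<close> sin\<gamma> by simp
  then have d\<delta>: "d - \<delta> > 0" using \<delta> unfolding \<delta>_def by argo
  have ratio: "(R + \<delta>) * sin \<gamma> \<le> d - 2 * \<delta>"
  proof -
    have "\<delta> * sin \<gamma> \<le> \<delta>" using \<delta> by (simp add: mult_left_le)
    then show ?thesis using \<delta>3 by (simp add: distrib_right)
  qed
  obtain N where N: "\<And>k. k \<ge> N \<Longrightarrow> \<exists>w\<in>D. norm (y k - w) \<le> \<delta>"
      "\<And>k. k \<ge> N \<Longrightarrow> f (x k) \<ge> f a + (d - 2 * \<delta>) * norm (x k - a)"
    using eventually_conj[OF eventually_subgradient_near[OF cont lim sub \<delta>]
        sgqp_linear_growth[OF cont run lim \<delta>]]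
    unfolding eventually_sequentially d_def D_def by blast
  have ylo: "norm (y k) \<ge> d - \<delta>" and yhi: "norm (y k) \<le> R + \<delta>" if "k \<ge> N" for k
  proof -
    obtain w where w: "w \<in> D" "norm (y k - w) \<le> \<delta>" using N(1)[OF \<open>k \<ge> N\<close>] by blast
    show "norm (y k) \<ge> d - \<delta>"
      using w d[OF w(1)] norm_triangle_ineq2[of w "y k"] by (simp add: norm_minus_commute)
    show "norm (y k) \<le> R + \<delta>"
      using w R[OF w(1)] norm_triangle_ineq2[of "y k" w] by simp
  qed
  have y0: "y k \<noteq> 0" if "k \<ge> N" for k
    using ylo[OF that] d\<delta> by auto
  show thesis
  proof (rule that[of "sin (\<gamma> - \<alpha>) * (d - \<delta>)" N])
    have s: "sin (\<gamma> - \<alpha>) > 0" using \<gamma> \<gamma>2 \<open>\<alpha> > 0\<close> by (intro sin_gt_zero) auto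
    then show "sin (\<gamma> - \<alpha>) * (d - \<delta>) > 0" using d\<delta> by simp
    fix j k assume j: "j \<ge> N" and k: "k \<ge> N" and angle: "angle0 (y j) (y k) \<le> \<alpha>"
    have "sin \<gamma> * (norm (y k) * norm (x k - a)) \<le> sin \<gamma> * ((R + \<delta>) * norm (x k - a))"
      using yhi[OF k] sin\<gamma> by (intro mult_left_mono mult_right_mono) auto
    also have "\<dots> \<le> (d - 2 * \<delta>) * norm (x k - a)"
      using mult_right_mono[OF ratio, of "norm (x k - a)"] by (simp add: mult_ac)
    also have "\<dots> \<le> y k \<bullet> (x k - a)"
      using N(2)[OF k] subdifferential_ineq[OF sub[of k], of a] by (simp add: inner_diff_right)
    finally have "sin (\<gamma> - \<alpha>) * (norm (y j) * norm (x k - a)) \<le> y j \<bullet> (x k - a)"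
      using y0[OF j] y0[OF k] ne[of k] angle \<gamma> \<gamma>2
      by (intro inner_ge_of_angle0_le[where v = "y k"]) auto
    moreover have "sin (\<gamma> - \<alpha>) * ((d - \<delta>) * norm (x k - a))
        \<le> sin (\<gamma> - \<alpha>) * (norm (y j) * norm (x k - a))"
      using ylo[OF j] s by (intro mult_left_mono mult_right_mono) auto
    ultimately show "y j \<bullet> (x k - a) \<ge> sin (\<gamma> - \<alpha>) * (d - \<delta>) * norm (x k - a)"
      by (simp add: mult.assoc)
  qed
qed

lemma sgqp_fejer_monotone:
  assumes "sgqp_run f x0 p x y S" "f c \<le> 0" "i \<le> j"
  shows "norm (x j - c) \<le> norm (x i - c)"
  using assms(3)
proof (induction rule: dec_induct)
  case (step n)
  have "norm (x (Suc n) - c) \<le> norm (x n - c)"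
    using assms(1,2) unfolding sgqp_run_def by simp
  then show ?case using step.IH by linarith
qed simp

section \<open>Rates of convergence\<close>

theorem theorem4p4:
  fixes f :: "real ^ 'n \<Rightarrow> real"
    and x0 xbar :: "real ^ 'n"
    and p :: nat
    and x y :: "nat \<Rightarrow> real ^ 'n"
    and S :: "nat \<Rightarrow> nat set"
    and \<alpha> :: real
  assumes "convex_on UNIV f"
    and "p > 0"
    and "sgqp_run f x0 p x y S"
    and "x \<longlonglongrightarrow> xbar"
    and "f xbar = 0"
    and "0 \<notin> subdifferential f xbar"
    and "\<forall>i. x i \<noteq> xbar"
    and "\<alpha> > 0"
    and "\<alpha> < arcsin (infdist 0 (subdifferential f xbar) / (SUP v\<in>subdifferential f xbar. norm v))"
    and "\<forall>u :: nat \<Rightarrow> real ^ 'n. (\<forall>i<p. norm (u i) = 1) \<longrightarrow>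
           (\<exists>i<p. \<exists>j<p. i \<noteq> j \<and> angle0 (u i) (u j) \<le> \<alpha>)"
  shows "(\<forall>\<epsilon>>0. \<exists>I>0. \<forall>i j k. I < i \<and> i < k \<and> j \<in> {i..k - 1} \<inter> S (k - 1) \<and> angle0 (y j) (y k) \<le> \<alpha> \<longrightarrow>
            norm (x k - xbar) / norm (x i - xbar) \<le> norm (x k - xbar) / norm (x j - xbar) \<and>
            norm (x k - xbar) / norm (x j - xbar) \<le> \<epsilon>)
       \<and> (strongly_semismooth_at f xbar \<longrightarrow>
          (\<exists>M>0. \<exists>I>0. \<forall>i j k. I < i \<and> i < k \<and> j \<in> {i..k - 1} \<inter> S (k - 1) \<and> angle0 (y j) (y k) \<le> \<alpha> \<longrightarrow>
            norm (x k - xbar) / (norm (x i - xbar))\<^sup>2 \<le> norm (x k - xbar) / (norm (x j - xbar))\<^sup>2 \<and>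
            norm (x k - xbar) / (norm (x j - xbar))\<^sup>2 < M))"
proof -
  have "continuous_on UNIV f"
    using assms(1) by (intro convex_on_continuous) auto
  note cont = this and run = assms(3) and lim = assms(4) and f0 = assms(5)
  have sub: "\<And>i. y i \<in> subdifferential f (x i)"
    and cut: "\<And>i j. j \<in> S i \<Longrightarrow> f (x j) + y j \<bullet> (x (Suc i) - x j) \<le> 0"
    using run unfolding sgqp_run_def halfspace_le_def by auto
  have pos: "norm (x i - xbar) > 0" for i
    using assms(7) by simp
  have mono: "norm (x j - xbar) \<le> norm (x i - xbar)" if "i \<le> j" for i j
    using sgqp_fejer_monotone[OF run _ that, of xbar] f0 by simp
  obtain \<kappa> N where \<kappa>: "\<kappa> > 0"
    and aligned: "\<And>j k. j \<ge> N \<Longrightarrow> k \<ge> N \<Longrightarrow> angle0 (y j) (y k) \<le> \<alpha>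
        \<Longrightarrow> y j \<bullet> (x k - xbar) \<ge> \<kappa> * norm (x k - xbar)"
    using assms(6-9) sgqp_aligned_subgradient[OF cont run lim] by blast
  have key: "\<kappa> * norm (x k - xbar) \<le> y j \<bullet> (x j - xbar) - f (x j)"
    if "j \<ge> N" "j < k" "j \<in> S (k - 1)" "angle0 (y j) (y k) \<le> \<alpha>" for j k
  proof -
    have "\<kappa> * norm (x k - xbar) \<le> y j \<bullet> (x k - xbar)"
      using aligned[of j k] that by simp
    also have "\<dots> = y j \<bullet> (x k - x j) + y j \<bullet> (x j - xbar)"
      by (simp add: inner_diff_right)
    also have "\<dots> \<le> y j \<bullet> (x j - xbar) - f (x j)"
      using cut[OF that(3)] that(2) by simp
    finally show ?thesis .
  qed
  show ?thesis
  proof (intro conjI impI allI)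
    fix \<epsilon> :: real assume \<epsilon>: "\<epsilon> > 0"
    obtain N' where N': "\<And>j. j \<ge> N' \<Longrightarrow> y j \<bullet> (x j - xbar) - f (x j) \<le> (\<epsilon> * \<kappa>) * norm (x j - xbar)"
      using eventually_linearization_error[OF cont lim sub, of "\<epsilon> * \<kappa>"] \<epsilon> \<kappa> f0
      unfolding eventually_sequentially by auto
    have rate: "norm (x k - xbar) / norm (x i - xbar) \<le> norm (x k - xbar) / norm (x j - xbar) \<and>
          norm (x k - xbar) / norm (x j - xbar) \<le> \<epsilon>"
      if h: "Suc (N + N') < i \<and> i < k \<and> j \<in> {i..k - 1} \<inter> S (k - 1) \<and> angle0 (y j) (y k) \<le> \<alpha>" for i j k
    proof
      show "norm (x k - xbar) / norm (x i - xbar) \<le> norm (x k - xbar) / norm (x j - xbar)"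
        using h mono[of i j] pos by (intro divide_left_mono) auto
      have "\<kappa> * norm (x k - xbar) \<le> \<kappa> * (\<epsilon> * norm (x j - xbar))"
        using key[of j k] N'[of j] h by (force simp: mult_ac)
      then show "norm (x k - xbar) / norm (x j - xbar) \<le> \<epsilon>"
        using \<kappa> pos by (simp add: pos_divide_le_eq)
    qed
    show "\<exists>I>0. \<forall>i j k. I < i \<and> i < k \<and> j \<in> {i..k - 1} \<inter> S (k - 1) \<and> angle0 (y j) (y k) \<le> \<alpha> \<longrightarrow>
        norm (x k - xbar) / norm (x i - xbar) \<le> norm (x k - xbar) / norm (x j - xbar) \<and>
        norm (x k - xbar) / norm (x j - xbar) \<le> \<epsilon>"
      by (rule exI[of _ "Suc (N + N')"], rule conjI, simp) (use rate in blast)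
  next
    assume "strongly_semismooth_at f xbar"
    then obtain C where C: "\<forall>\<^sub>F h in at 0. \<forall>V \<in> subdifferential f (xbar + h).
        \<bar>f (xbar + h) - f xbar - V \<bullet> h\<bar> \<le> C * (norm h)\<^sup>2"
      unfolding strongly_semismooth_at_def by blast
    have "filterlim (\<lambda>i. x i - xbar) (at 0) sequentially"
      using lim assms(7) by (auto simp: filterlim_at LIM_zero)
    from eventually_compose_filterlim[OF C this]
    have "\<forall>\<^sub>F i in sequentially. y i \<bullet> (x i - xbar) - f (x i) \<le> C * (norm (x i - xbar))\<^sup>2"
    proof eventually_elim
      case (elim i)
      have "\<bar>f (x i) - y i \<bullet> (x i - xbar)\<bar> \<le> C * (norm (x i - xbar))\<^sup>2"
        using elim sub[of i] f0 by simp
      then show ?case by linarith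
    qed
    then obtain N' where N': "\<And>j. j \<ge> N' \<Longrightarrow> y j \<bullet> (x j - xbar) - f (x j) \<le> C * (norm (x j - xbar))\<^sup>2"
      unfolding eventually_sequentially by blast
    \<comment> \<open>The constant \<open>C\<close> may be negative or zero, and the bound by \<open>M\<close> is strict.\<close>
    define M where "M = (\<bar>C\<bar> + 1) / \<kappa>"
    have M: "M > 0" using \<kappa> by (simp add: M_def)
    have rate: "norm (x k - xbar) / (norm (x i - xbar))\<^sup>2 \<le> norm (x k - xbar) / (norm (x j - xbar))\<^sup>2 \<and>
          norm (x k - xbar) / (norm (x j - xbar))\<^sup>2 < M"
      if h: "Suc (N + N') < i \<and> i < k \<and> j \<in> {i..k - 1} \<inter> S (k - 1) \<and> angle0 (y j) (y k) \<le> \<alpha>" for i j k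
    proof
      have "norm (x j - xbar) \<le> norm (x i - xbar)" using h mono[of i j] by simp
      then show "norm (x k - xbar) / (norm (x i - xbar))\<^sup>2 \<le> norm (x k - xbar) / (norm (x j - xbar))\<^sup>2"
        using pos by (intro divide_left_mono power_mono mult_pos_pos zero_less_power) auto
      have sq: "(norm (x j - xbar))\<^sup>2 > 0" using pos by simp
      have "\<kappa> * norm (x k - xbar) \<le> C * (norm (x j - xbar))\<^sup>2"
        using key[of j k] N'[of j] h by force
      also have "\<dots> < (\<bar>C\<bar> + 1) * (norm (x j - xbar))\<^sup>2"
        using sq by (intro mult_strict_right_mono) auto
      also have "\<dots> = \<kappa> * (M * (norm (x j - xbar))\<^sup>2)"
        using \<kappa> by (simp add: M_def)
      finally show "norm (x k - xbar) / (norm (x j - xbar))\<^sup>2 < M"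
        using \<kappa> sq by (simp add: pos_divide_less_eq)
    qed
    show "\<exists>M>0. \<exists>I>0. \<forall>i j k. I < i \<and> i < k \<and> j \<in> {i..k - 1} \<inter> S (k - 1) \<and> angle0 (y j) (y k) \<le> \<alpha> \<longrightarrow>
        norm (x k - xbar) / (norm (x i - xbar))\<^sup>2 \<le> norm (x k - xbar) / (norm (x j - xbar))\<^sup>2 \<and>
        norm (x k - xbar) / (norm (x j - xbar))\<^sup>2 < M"
      by (rule exI[of _ M], rule conjI[OF M], rule exI[of _ "Suc (N + N')"], rule conjI, simp) (use rate in blast)
  qed
qed

end
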